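(* Let $N_n$ denote the number of irreducible supermodular functions $f\colon 2^{[n]}\to\mathbb{R}$, counted up to equivalence. Then $N_n\le 2^{O(n2^n)}$ and $N_n\ge 2^{\Omega(2^n/n^{3/2})}$ as $n\to\infty$.
   Context: A function $f\colon 2^{[n]}\to\mathbb{R}$ is supermodular if $f(I\cap J)+f(I\cup J)\ge f(I)+f(J)$ for all $I,J\subseteq[n]$, and modular if equality holds for all $I,J$. Two supermodular functions are equivalent if they differ by a modular function. A supermodular function $f$ is irreducible if it is not modular and whenever $f=g_1+g_2$ with $g_1,g_2$ supermodular, each $g_i$ is equivalent to $c_if$ for some $c_i\in\mathbb{R}_{\ge0}$. Irreducible functions are counted up to equivalence and positive scaling, i.e. $f$ and $g$ are identified if $g-cf$ is modular for some $c>0$ (each class has a unique representative with $f(I)=0$ for $|I|\le1$ taking nonnegative integer values with greatest common divisor $1$). *)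

theory Defs
  imports Complex_Main "HOL-Library.Landau_Symbols"
begin

text \<open>
  A function $2^{[n]} \to R$ is represented by a total function on \<^typ>\<open>nat set\<close>, of which
  only the values on \<^term>\<open>Pow {1..n}\<close> matter. The values elsewhere are arbitrary; this does not
  affect the count below, because functions that agree on \<^term>\<open>Pow {1..n}\<close> are identified there.
\<close>

definition supermodular :: "nat \<Rightarrow> (nat set \<Rightarrow> real) \<Rightarrow> bool" where
  "supermodular n f \<longleftrightarrow>
     (\<forall>I J. I \<subseteq> {1..n} \<longrightarrow> J \<subseteq> {1..n} \<longrightarrow> f (I \<inter> J) + f (I \<union> J) \<ge> f I + f J)"

definition modular :: "nat \<Rightarrow> (nat set \<Rightarrow> real) \<Rightarrow> bool" where
  "modular n f \<longleftrightarrow>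
     (\<forall>I J. I \<subseteq> {1..n} \<longrightarrow> J \<subseteq> {1..n} \<longrightarrow> f (I \<inter> J) + f (I \<union> J) = f I + f J)"

definition equivalent :: "nat \<Rightarrow> (nat set \<Rightarrow> real) \<Rightarrow> (nat set \<Rightarrow> real) \<Rightarrow> bool" where
  "equivalent n f g \<longleftrightarrow> modular n (\<lambda>I. f I - g I)"

definition irreducible_supermodular :: "nat \<Rightarrow> (nat set \<Rightarrow> real) \<Rightarrow> bool" where
  "irreducible_supermodular n f \<longleftrightarrow>
     supermodular n f \<and> \<not> modular n f \<and>
     (\<forall>g1 g2. supermodular n g1 \<longrightarrow> supermodular n g2 \<longrightarrow>
        (\<forall>I. I \<subseteq> {1..n} \<longrightarrow> f I = g1 I + g2 I) \<longrightarrow>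
        (\<exists>c1\<ge>0. equivalent n g1 (\<lambda>I. c1 * f I)) \<and>
        (\<exists>c2\<ge>0. equivalent n g2 (\<lambda>I. c2 * f I)))"

definition irreducible_rel :: "nat \<Rightarrow> ((nat set \<Rightarrow> real) \<times> (nat set \<Rightarrow> real)) set" where
  "irreducible_rel n =
     {(f, g). irreducible_supermodular n f \<and> irreducible_supermodular n g \<and>
              (\<exists>c>0. equivalent n g (\<lambda>I. c * f I))}"

definition irreducible_classes :: "nat \<Rightarrow> (nat set \<Rightarrow> real) set set" where
  "irreducible_classes n = {f. irreducible_supermodular n f} // irreducible_rel n"

definition num_irreducible :: "nat \<Rightarrow> nat" where
  "num_irreducible n = card (irreducible_classes n)"

lemma modular_scale: "modular n f \<Longrightarrow> modular n (\<lambda>I. c * f I)"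
  by (simp add: modular_def flip: distrib_left)

lemma modular_add: "modular n f \<Longrightarrow> modular n g \<Longrightarrow> modular n (\<lambda>I. f I + g I)"
  by (simp add: modular_def algebra_simps)

lemma equiv_irreducible_rel: "equiv {f. irreducible_supermodular n f} (irreducible_rel n)"
proof (rule equivI)
  show "irreducible_rel n \<subseteq> {f. irreducible_supermodular n f} \<times> {f. irreducible_supermodular n f}"
    by (auto simp: irreducible_rel_def)
  show "refl_on {f. irreducible_supermodular n f} (irreducible_rel n)"
    by (auto simp: refl_on_def irreducible_rel_def equivalent_def modular_def intro!: exI[of _ 1])
  show "sym (irreducible_rel n)"
  proof (rule symI)
    fix f g assume fg: "(f, g) \<in> irreducible_rel n"
    then obtain c where c: "c > 0" "modular n (\<lambda>I. g I - c * f I)"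
      by (auto simp: irreducible_rel_def equivalent_def)
    have "modular n (\<lambda>I. (- inverse c) * (g I - c * f I))"
      using c(2) by (rule modular_scale)
    also have "(\<lambda>I. (- inverse c) * (g I - c * f I)) = (\<lambda>I. f I - inverse c * g I)"
      using c(1) by (simp add: fun_eq_iff right_diff_distrib flip: mult.assoc)
    finally show "(g, f) \<in> irreducible_rel n"
      using fg c(1) by (auto simp: irreducible_rel_def equivalent_def intro!: exI[of _ "inverse c"])
  qed
  show "trans (irreducible_rel n)"
  proof (rule transI)
    fix f g h assume fg: "(f, g) \<in> irreducible_rel n" and gh: "(g, h) \<in> irreducible_rel n"
    obtain c where c: "c > 0" "modular n (\<lambda>I. g I - c * f I)"
      using fg by (auto simp: irreducible_rel_def equivalent_def)
    obtain d where d: "d > 0" "modular n (\<lambda>I. h I - d * g I)"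
      using gh by (auto simp: irreducible_rel_def equivalent_def)
    have "modular n (\<lambda>I. (h I - d * g I) + d * (g I - c * f I))"
      using d(2) modular_scale[OF c(2)] by (rule modular_add)
    also have "(\<lambda>I. (h I - d * g I) + d * (g I - c * f I)) = (\<lambda>I. h I - (d * c) * f I)"
      by (simp add: algebra_simps)
    finally show "(f, h) \<in> irreducible_rel n"
      using fg gh c(1) d(1)
      by (auto simp: irreducible_rel_def equivalent_def intro!: exI[of _ "d * c"])
  qed
qed

end

theory Submission
  imports Defs "HOL-Library.Function_Algebras"
begin

text \<open>
  Upper bound: an irreducible \<open>f\<close> is determined up to equivalence and scaling by the pairs \<open>(I, J)\<close> at
  which it is tight. As linear functionals, these tight pairs are spanned by at most \<open>2 ^ n\<close> of the
  \<open>4 ^ n\<close> available pairs, which leaves \<open>(4 ^ n) ^ O(2 ^ n)\<close> possibilities.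

  Lower bound: the nullity function \<open>max (\<bar>I\<bar> - k) 0 + [I \<in> C]\<close> of a sparse paving matroid is irreducible
  for every family \<open>C\<close> of \<open>k\<close>-sets that pairwise meet in at most \<open>k - 2\<close> elements, and different families
  give inequivalent functions. For \<open>k = n div 2\<close>, the \<open>k\<close>-sets with a given element sum modulo \<open>n\<close> form
  such a family; one of these \<open>n\<close> families has at least \<open>(n choose k) / n\<close> members, and all its
  subfamilies qualify.
\<close>

section \<open>Defects and tight pairs\<close>

text \<open>The set function is the last argument so that \<open>defect I J\<close> is itself a
  linear functional, and spans of such functionals can be formed.\<close>

definition defect :: "nat set \<Rightarrow> nat set \<Rightarrow> (nat set \<Rightarrow> real) \<Rightarrow> real" where
  "defect I J f = f (I \<inter> J) + f (I \<union> J) - f I - f J"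

lemma defect_diff: "defect I J (\<lambda>K. f K - g K) = defect I J f - defect I J g"
  by (simp add: defect_def)

lemma defect_scale: "defect I J (\<lambda>K. c * f K) = c * defect I J f"
  by (simp add: defect_def algebra_simps)

lemma supermodular_iff_defect:
  "supermodular n f \<longleftrightarrow> (\<forall>I\<subseteq>{1..n}. \<forall>J\<subseteq>{1..n}. 0 \<le> defect I J f)"
proof -
  have "0 \<le> defect I J f \<longleftrightarrow> f (I \<inter> J) + f (I \<union> J) \<ge> f I + f J" for I J
    by (auto simp: defect_def)
  then show ?thesis unfolding supermodular_def by blast
qed

lemma modular_iff_defect:
  "modular n f \<longleftrightarrow> (\<forall>I\<subseteq>{1..n}. \<forall>J\<subseteq>{1..n}. defect I J f = 0)"
proof -
  have "defect I J f = 0 \<longleftrightarrow> f (I \<inter> J) + f (I \<union> J) = f I + f J" for I J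
    by (auto simp: defect_def)
  then show ?thesis unfolding modular_def by blast
qed

lemma equivalent_iff_defect:
  "equivalent n g f \<longleftrightarrow> (\<forall>I\<subseteq>{1..n}. \<forall>J\<subseteq>{1..n}. defect I J g = defect I J f)"
  by (simp add: equivalent_def modular_iff_defect defect_diff)

text \<open>Supplies one step size for all non-tight pairs at once, which exists because there are
  finitely many of them.\<close>

lemma exists_uniform_scale:
  fixes a b :: "'a \<Rightarrow> real"
  assumes "finite P" "\<And>p. p \<in> P \<Longrightarrow> 0 < a p" "\<And>p. p \<in> P \<Longrightarrow> 0 \<le> b p"
  shows "\<exists>\<epsilon>>0. \<forall>p\<in>P. \<epsilon> * b p \<le> a p"
  using assms
proof (induction P rule: finite_induct)
  case empty
  show ?case by (auto intro: exI[of _ 1])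
next
  case (insert p P)
  then obtain \<epsilon> where \<epsilon>: "\<epsilon> > 0" "\<forall>q\<in>P. \<epsilon> * b q \<le> a q" by auto
  \<comment> \<open>The added 1 keeps the denominator positive when \<open>b p = 0\<close>.\<close>
  define \<delta> where "\<delta> = min \<epsilon> (a p / (b p + 1))"
  have pos: "a p > 0" "b p \<ge> 0" using insert.prems by auto
  have "\<delta> > 0" using \<epsilon> pos by (simp add: \<delta>_def)
  moreover have "\<delta> * b p \<le> a p"
  proof -
    have "\<delta> * b p \<le> a p / (b p + 1) * (b p + 1)"
      using pos \<open>\<delta> > 0\<close> by (intro mult_mono) (auto simp: \<delta>_def)
    then show ?thesis using pos by simp
  qed
  moreover have "\<delta> * b q \<le> a q" if "q \<in> P" for q
  proof -
    have "\<delta> * b q \<le> \<epsilon> * b q" using insert.prems that by (intro mult_right_mono) (auto simp: \<delta>_def)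
    then show ?thesis using \<epsilon> that by force
  qed
  ultimately show ?case by auto
qed

text \<open>If every tight pair of \<open>f\<close> is tight for \<open>g\<close>, then \<open>f - \<epsilon> g\<close> is supermodular for small
  \<open>\<epsilon> > 0\<close>, which splits \<open>f\<close>.\<close>

lemma irreducible_tight_imp_equivalent:
  assumes f: "irreducible_supermodular n f" and g: "supermodular n g" "\<not> modular n g"
    and tight: "\<And>I J. I \<subseteq> {1..n} \<Longrightarrow> J \<subseteq> {1..n} \<Longrightarrow> defect I J f = 0 \<Longrightarrow> defect I J g = 0"
  shows "\<exists>c>0. equivalent n g (\<lambda>I. c * f I)"
proof -
  let ?P = "{p \<in> Pow {1..n} \<times> Pow {1..n}. defect (fst p) (snd p) f \<noteq> 0}"
  have sf: "supermodular n f" using f by (simp add: irreducible_supermodular_def)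
  have "\<exists>\<epsilon>>0. \<forall>p\<in>?P. \<epsilon> * defect (fst p) (snd p) g \<le> defect (fst p) (snd p) f"
  proof (rule exists_uniform_scale)
    show "finite ?P" by simp
    show "0 < defect (fst p) (snd p) f" if "p \<in> ?P" for p
      using that sf by (force simp: supermodular_iff_defect less_le)
    show "0 \<le> defect (fst p) (snd p) g" if "p \<in> ?P" for p
      using that g(1) by (force simp: supermodular_iff_defect)
  qed
  then obtain \<epsilon> where \<epsilon>: "\<epsilon> > 0"
    "\<And>I J. I \<subseteq> {1..n} \<Longrightarrow> J \<subseteq> {1..n} \<Longrightarrow> defect I J f \<noteq> 0 \<Longrightarrow> \<epsilon> * defect I J g \<le> defect I J f"
    by auto
  have s1: "supermodular n (\<lambda>I. f I - \<epsilon> * g I)"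
    unfolding supermodular_iff_defect defect_diff defect_scale
    using \<epsilon>(2) tight by (metis diff_ge_0_iff_ge mult_zero_right order_refl)
  have s2: "supermodular n (\<lambda>I. \<epsilon> * g I)"
    using g(1) \<epsilon>(1) by (simp add: supermodular_iff_defect defect_scale)
  have "\<exists>c\<ge>0. equivalent n (\<lambda>I. \<epsilon> * g I) (\<lambda>I. c * f I)"
    using f s1 s2 unfolding irreducible_supermodular_def by force
  then obtain c where c: "c \<ge> 0"
    "\<And>I J. I \<subseteq> {1..n} \<Longrightarrow> J \<subseteq> {1..n} \<Longrightarrow> \<epsilon> * defect I J g = c * defect I J f"
    by (auto simp: equivalent_iff_defect defect_scale)
  \<comment> \<open>With \<open>c = 0\<close> every defect of \<open>g\<close> would vanish, making
    \<open>g\<close> modular; the relation between classes needs a positive factor.\<close>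
  have "c \<noteq> 0"
    using g(2) c(2) \<epsilon>(1) by (auto simp: modular_iff_defect)
  moreover have "equivalent n g (\<lambda>I. c / \<epsilon> * f I)"
    unfolding equivalent_iff_defect defect_scale using c(2) \<epsilon>(1) by (auto simp: field_simps)
  ultimately show ?thesis using c(1) \<epsilon>(1) by (intro exI[of _ "c / \<epsilon>"]) auto
qed

section \<open>The upper bound\<close>

text \<open>Used with set functions as the argument type, so that the vectors are functionals such
  as \<open>defect I J\<close>.\<close>

interpretation real_fun: vector_space "\<lambda>(c::real) (\<phi>::'a \<Rightarrow> real) x. c * \<phi> x"
  by unfold_locales (auto simp: fun_eq_iff algebra_simps)

definition tight_functionals :: "nat \<Rightarrow> (nat set \<Rightarrow> real) \<Rightarrow> ((nat set \<Rightarrow> real) \<Rightarrow> real) set" where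
  "tight_functionals n f = {defect I J | I J. I \<subseteq> {1..n} \<and> J \<subseteq> {1..n} \<and> defect I J f = 0}"

text \<open>Functionals that vanish at a fixed \<open>x\<close> form a subspace. This carries
  tightness from a spanning set to all functionals in its span.\<close>

lemma real_fun_span_vanish:
  assumes "\<phi> \<in> real_fun.span B" "\<And>\<psi>. \<psi> \<in> B \<Longrightarrow> \<psi> x = 0"
  shows "\<phi> x = 0"
proof -
  have "real_fun.subspace {\<phi>. \<phi> x = 0}"
    by (auto simp: real_fun.subspace_def)
  then show ?thesis
    using assms real_fun.span_induct[of \<phi> B "\<lambda>\<phi>. \<phi> x = 0"] by simp
qed

lemma defect_in_span:
  assumes "I \<subseteq> {1..n}" "J \<subseteq> {1..n}"
  shows "defect I J \<in> real_fun.span ((\<lambda>K f. f K) ` Pow {1..n})"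
proof -
  have ev: "(\<lambda>f::nat set \<Rightarrow> real. f K) \<in> real_fun.span ((\<lambda>K f. f K) ` Pow {1..n})" if "K \<subseteq> {1..n}" for K
    using that by (intro real_fun.span_base) auto
  have "defect I J = (\<lambda>f. f (I \<inter> J)) + (\<lambda>f. f (I \<union> J)) - (\<lambda>f. f I) - (\<lambda>f. f J)"
    by (simp add: fun_eq_iff defect_def)
  also have "\<dots> \<in> real_fun.span ((\<lambda>K f. f K) ` Pow {1..n})"
    using assms by (intro real_fun.span_add real_fun.span_diff ev) auto
  finally show ?thesis .
qed

text \<open>Take a maximal independent subset. It lies in the span of the evaluations at the
  \<open>2 ^ n\<close> subsets of \<open>{1..n}\<close>, which bounds its size although the space of
  all functionals is infinite-dimensional.\<close>

lemma tight_functionals_basis: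
  obtains B where "B \<subseteq> tight_functionals n f" "finite B" "card B \<le> 2 ^ n"
    "tight_functionals n f \<subseteq> real_fun.span B"
proof -
  let ?E = "(\<lambda>K (f::nat set \<Rightarrow> real). f K) ` Pow {1..n}"
  obtain B where B: "B \<subseteq> tight_functionals n f" "real_fun.independent B"
    "tight_functionals n f \<subseteq> real_fun.span B"
    using real_fun.maximal_independent_subset by blast
  have "tight_functionals n f \<subseteq> real_fun.span ?E"
    unfolding tight_functionals_def using defect_in_span by blast
  then have "B \<subseteq> real_fun.span ?E" using B(1) by (rule subset_trans[rotated])
  then have "finite B \<and> card B \<le> card ?E"
    using B(2) by (intro real_fun.independent_span_bound) auto
  moreover have "card ?E \<le> 2 ^ n"
    using card_image_le[of "Pow {1..n}" "\<lambda>K (f::nat set \<Rightarrow> real). f K"] by (simp add: card_Pow)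
  ultimately show thesis using B by (intro that[of B]) auto
qed

text \<open>The right-hand side mentions only \<open>B\<close>, so a class is recovered from a small
  spanning set, and counting the possible \<open>B\<close> bounds the number of classes.\<close>

lemma irreducible_class_eq:
  assumes f: "irreducible_supermodular n f"
    and B: "B \<subseteq> tight_functionals n f" "tight_functionals n f \<subseteq> real_fun.span B"
  shows "irreducible_rel n `` {f} =
    {g. irreducible_supermodular n g \<and> B \<subseteq> tight_functionals n g}"
proof (intro equalityI subsetI)
  fix g assume "g \<in> irreducible_rel n `` {f}"
  then obtain c where g: "irreducible_supermodular n g" and c: "c > 0" "equivalent n g (\<lambda>I. c * f I)"
    by (auto simp: irreducible_rel_def)
  have "defect I J g = 0" if "I \<subseteq> {1..n}" "J \<subseteq> {1..n}" "defect I J f = 0" for I J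
    using c that unfolding equivalent_iff_defect defect_scale by simp
  then have "tight_functionals n f \<subseteq> tight_functionals n g"
    unfolding tight_functionals_def by blast
  then show "g \<in> {g. irreducible_supermodular n g \<and> B \<subseteq> tight_functionals n g}"
    using g B(1) by auto
next
  fix g assume "g \<in> {g. irreducible_supermodular n g \<and> B \<subseteq> tight_functionals n g}"
  then have g: "irreducible_supermodular n g" and Bg: "B \<subseteq> tight_functionals n g" by auto
  have "\<exists>c>0. equivalent n g (\<lambda>I. c * f I)"
  proof (rule irreducible_tight_imp_equivalent[OF f])
    show "supermodular n g" "\<not> modular n g"
      using g by (auto simp: irreducible_supermodular_def)
    fix I J assume IJ: "I \<subseteq> {1..n}" "J \<subseteq> {1..n}" "defect I J f = 0"
    then have "defect I J \<in> real_fun.span B"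
      using B(2) unfolding tight_functionals_def by blast
    then show "defect I J g = 0"
      by (rule real_fun_span_vanish) (use Bg in \<open>auto simp: tight_functionals_def\<close>)
  qed
  then show "g \<in> irreducible_rel n `` {f}"
    using f g by (auto simp: irreducible_rel_def)
qed

lemma irreducible_classes_bound:
  "finite (irreducible_classes n) \<and> num_irreducible n \<le> (4 ^ n) ^ (2 ^ n + 1)"
proof -
  define \<Phi> where "\<Phi> = (\<lambda>(I, J). defect I J) ` (Pow {1..n} \<times> Pow {1..n})"
  \<comment> \<open>Lists of fixed length are easy to count. The extra entry ensures that the
    padding is nonempty even when a basis has all \<open>2 ^ n\<close> elements.\<close>
  define L where "L = {xs. set xs \<subseteq> \<Phi> \<and> length xs = 2 ^ n + 1}"
  let ?F = "\<lambda>xs. {g. irreducible_supermodular n g \<and> set xs \<subseteq> tight_functionals n g}"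
  have fin\<Phi>: "finite \<Phi>" by (simp add: \<Phi>_def)
  have "card \<Phi> \<le> card (Pow {1..n} \<times> Pow {1..n})"
    unfolding \<Phi>_def by (rule card_image_le) simp
  also have "\<dots> = 4 ^ n"
    by (simp add: card_Pow card_cartesian_product flip: power_mult_distrib)
  finally have card\<Phi>: "card \<Phi> \<le> 4 ^ n" .
  have finL: "finite L" unfolding L_def using fin\<Phi> by (rule finite_lists_length_eq)
  have cardL: "card L \<le> (4 ^ n) ^ (2 ^ n + 1)"
    unfolding L_def card_lists_length_eq[OF fin\<Phi>] using card\<Phi> by (intro power_mono) auto
  have sub: "irreducible_classes n \<subseteq> ?F ` L"
  proof
    fix X assume "X \<in> irreducible_classes n"
    then obtain f where f: "irreducible_supermodular n f" and X: "X = irreducible_rel n `` {f}"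
      by (auto simp: irreducible_classes_def quotient_def)
    obtain B where B: "B \<subseteq> tight_functionals n f" "finite B" "card B \<le> 2 ^ n"
      "tight_functionals n f \<subseteq> real_fun.span B"
      using tight_functionals_basis by blast
    obtain xs where xs: "set xs = B" "length xs = card B"
      using finite_distinct_list[OF B(2)] distinct_card by metis
    \<comment> \<open>Pad to a fixed length with the functional \<open>defect {} {}\<close>, which is tight for every function.\<close>
    define ys where "ys = xs @ replicate (2 ^ n + 1 - card B) (defect {} {})"
    have ys: "set ys = insert (defect {} {}) B"
      using xs B(3) by (auto simp: ys_def)
    have "defect {} {} \<in> tight_functionals n f"
      by (force simp: tight_functionals_def defect_def)
    then have sub: "set ys \<subseteq> tight_functionals n f" using ys B(1) by simp
    have "tight_functionals n f \<subseteq> real_fun.span (set ys)"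
      using B(4) real_fun.span_mono[of B "set ys"] ys by auto
    with sub have "X = ?F ys" unfolding X by (intro irreducible_class_eq[OF f])
    moreover have "tight_functionals n f \<subseteq> \<Phi>"
      by (auto simp: tight_functionals_def \<Phi>_def)
    then have "ys \<in> L" using sub xs B(3) by (auto simp: L_def ys_def)
    ultimately show "X \<in> ?F ` L" by blast
  qed
  have "num_irreducible n \<le> card L"
    unfolding num_irreducible_def using surj_card_le[OF finL sub] .
  then show ?thesis using finite_subset[OF sub] finL cardL by auto
qed

section \<open>Nullity functions of sparse paving matroids\<close>

lemma modular_zero_if_small_zero:
  assumes m: "modular n f" and small: "\<And>I. I \<subseteq> {1..n} \<Longrightarrow> card I \<le> 1 \<Longrightarrow> f I = 0"
    and I: "I \<subseteq> {1..n}"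
  shows "f I = 0"
proof -
  have "finite I" using I finite_subset by blast
  then show ?thesis using I
  proof (induction I rule: finite_induct)
    case empty
    then show ?case by (simp add: small)
  next
    case (insert x I)
    have "f (I \<inter> {x}) + f (I \<union> {x}) = f I + f {x}"
      using m[unfolded modular_def, rule_format, of I "{x}"] insert.prems by simp
    moreover have "I \<inter> {x} = {}" using insert.hyps by auto
    ultimately show ?case using insert by (simp add: small)
  qed
qed

text \<open>The modular function that agrees with \<open>g\<close> on the empty set and on
  singletons; subtracting it normalizes \<open>g\<close> without changing any defect.\<close>

definition modular_part :: "(nat set \<Rightarrow> real) \<Rightarrow> nat set \<Rightarrow> real" where
  "modular_part g I = g {} + (\<Sum>i\<in>I. g {i} - g {})"

lemma defect_modular_part:
  assumes "finite I" "finite J"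
  shows "defect I J (modular_part g) = 0"
  using sum.union_inter[OF assms, of "\<lambda>i. g {i} - g {}"]
  by (simp add: defect_def modular_part_def)

lemma modular_part_small: "finite I \<Longrightarrow> card I \<le> 1 \<Longrightarrow> modular_part g I = g I"
  by (auto simp: modular_part_def le_Suc_eq card_1_singleton_iff)

text \<open>Subtraction of naturals truncates, so the first term is the nullity of the uniform
  matroid of rank \<open>k\<close>; each member of \<open>C\<close> gets one extra unit.\<close>

definition paving_nullity :: "nat \<Rightarrow> nat set set \<Rightarrow> nat set \<Rightarrow> real" where
  "paving_nullity k C I = real (card I - k) + of_bool (I \<in> C)"

text \<open>\<open>C\<close> is the set of circuit-hyperplanes of a sparse paving matroid of rank \<open>k\<close> on \<open>{1..n}\<close>.\<close>

locale sparse_paving =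
  fixes n k :: nat and C :: "nat set set"
  assumes k_ge: "3 \<le> k" and k_le: "k + 2 \<le> n"
    and C_subset: "A \<in> C \<Longrightarrow> A \<subseteq> {1..n}"
    and C_card: "A \<in> C \<Longrightarrow> card A = k"
    and C_separated: "A \<in> C \<Longrightarrow> B \<in> C \<Longrightarrow> A \<noteq> B \<Longrightarrow> card (A \<inter> B) + 2 \<le> k"
begin

abbreviation f :: "nat set \<Rightarrow> real" where "f \<equiv> paving_nullity k C"

lemma f_not_mem: "card I \<noteq> k \<Longrightarrow> f I = real (card I - k)"
  using C_card by (auto simp: paving_nullity_def)

lemma f_zero: "card I \<le> k \<Longrightarrow> I \<notin> C \<Longrightarrow> f I = 0"
  by (simp add: paving_nullity_def)

lemma f_mem: "A \<in> C \<Longrightarrow> f A = 1"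
  using C_card by (simp add: paving_nullity_def)

text \<open>Otherwise two distinct members of \<open>C\<close> would share the \<open>k - 1\<close>
  elements of \<open>K - {x, y, z}\<close>, against separation.\<close>

lemma remove_remove_unique:
  assumes "finite K" "card K = k + 2" "x \<in> K" "y \<in> K" "z \<in> K" "x \<noteq> y" "x \<noteq> z"
    "K - {x, y} \<in> C" "K - {x, z} \<in> C"
  shows "y = z"
proof (rule ccontr)
  assume yz: "y \<noteq> z"
  have "K - {x, y} \<noteq> K - {x, z}" using assms yz by blast
  then have "card ((K - {x, y}) \<inter> (K - {x, z})) + 2 \<le> k"
    using assms C_separated by blast
  moreover have "(K - {x, y}) \<inter> (K - {x, z}) = K - {x, y, z}" by auto
  moreover have "card (K - {x, y, z}) = k - 1"
    using assms yz by (simp add: card_Diff_subset)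
  ultimately show False using k_ge by simp
qed

text \<open>For incomparable sets the union is strictly larger than both. This gain pays for the
  extra unit of a single member of \<open>C\<close>; two members have a union of at least
  \<open>k + 2\<close> elements, where \<open>f\<close> is at least 2.\<close>

lemma supermodular_f: "supermodular n f"
  unfolding supermodular_def
proof (intro allI impI)
  fix I J assume IJ: "I \<subseteq> {1..n}" "J \<subseteq> {1..n}"
  have fin: "finite I" "finite J" using IJ finite_subset by blast+
  have cards: "card (I \<inter> J) + card (I \<union> J) = card I + card J"
    using card_Un_Int[OF fin] by simp
  show "f (I \<inter> J) + f (I \<union> J) \<ge> f I + f J"
  proof (cases "I \<subseteq> J \<or> J \<subseteq> I")
    case True
    then show ?thesis by (auto simp: Int_absorb1 Int_absorb2 Un_absorb1 Un_absorb2)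
  next
    case False
    have lt: "card I < card (I \<union> J)" "card J < card (I \<union> J)"
      using False fin by (auto intro!: psubset_card_mono)
    have ge: "f (I \<inter> J) \<ge> real (card (I \<inter> J) - k)" "f (I \<union> J) \<ge> real (card (I \<union> J) - k)"
      by (auto simp: paving_nullity_def)
    consider "I \<notin> C" "J \<notin> C" | "I \<in> C" "J \<in> C" | "I \<in> C" "J \<notin> C" | "I \<notin> C" "J \<in> C" by blast
    then show ?thesis
    proof cases
      case 1
      have "real (card I - k) + real (card J - k) \<le> real (card (I \<inter> J) - k) + real (card (I \<union> J) - k)"
        using cards lt by linarith
      then show ?thesis using 1 ge by (simp add: paving_nullity_def)
    next
      case 2
      then have "card (I \<inter> J) + 2 \<le> k" using C_separated False by blast
      then have "card (I \<union> J) - k \<ge> 2" using cards 2 C_card by simp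
      then have "f (I \<union> J) \<ge> 2" using ge by linarith
      then show ?thesis using 2 ge f_mem by simp
    next
      case 3
      then have "f I + f J = 1 + real (card J - k)"
        using C_card[OF 3(1)] by (simp add: paving_nullity_def)
      moreover have "1 + (card J - k) \<le> card (I \<union> J) - k" using lt C_card[OF 3(1)] by linarith
      ultimately show ?thesis using ge by linarith
    next
      case 4
      then have "f I + f J = 1 + real (card I - k)"
        using C_card[OF 4(2)] by (simp add: paving_nullity_def)
      moreover have "1 + (card I - k) \<le> card (I \<union> J) - k" using lt C_card[OF 4(2)] by linarith
      ultimately show ?thesis using ge by linarith
    qed
  qed
qed

lemma f_small: "card I \<le> 1 \<Longrightarrow> f I = 0"
  using k_ge C_card by (intro f_zero) auto

lemma not_modular_f: "\<not> modular n f"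
proof
  assume "modular n f"
  then have "f {1..n} = 0"
    by (rule modular_zero_if_small_zero) (auto simp: f_small)
  then show False using k_le by (simp add: f_not_mem)
qed

text \<open>The hypothesis on \<open>g\<close> makes the pair \<open>(K - {x}, K - {y})\<close> tight whenever it is so for \<open>f\<close>;
  these pairs already determine \<open>g\<close> from its value on one \<open>(k + 1)\<close>-set.\<close>

lemma tight_normalized_imp_multiple:
  assumes small: "\<And>I. I \<subseteq> {1..n} \<Longrightarrow> card I \<le> 1 \<Longrightarrow> g I = 0"
    and tight: "\<And>I J. I \<subseteq> {1..n} \<Longrightarrow> J \<subseteq> {1..n} \<Longrightarrow> defect I J f = 0 \<Longrightarrow> defect I J g = 0"
  shows "\<exists>c. \<forall>I\<subseteq>{1..n}. g I = c * f I"
proof -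
  have fin: "finite I" if "I \<subseteq> {1..n}" for I using that finite_subset by blast
  have two: "\<exists>x y. x \<in> I \<and> y \<in> I \<and> x \<noteq> y" if two_le: "card I \<ge> 2" for I :: "nat set"
  proof -
    obtain T where "T \<subseteq> I" "card T = 2" by (rule obtain_subset_with_card_n[OF two_le])
    then show ?thesis by (auto simp: card_2_iff)
  qed
  have step: "g (K - {x}) + g (K - {y}) = g K + g (K - {x, y})"
    if "K \<subseteq> {1..n}" "x \<in> K" "y \<in> K" "x \<noteq> y"
      "f (K - {x}) + f (K - {y}) = f K + f (K - {x, y})" for K x y
  proof -
    have e: "(K - {x}) \<inter> (K - {y}) = K - {x, y}" "(K - {x}) \<union> (K - {y}) = K" using that by auto
    have d: "defect (K - {x}) (K - {y}) h = h (K - {x, y}) + h K - h (K - {x}) - h (K - {y})" for h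
      unfolding defect_def e by (rule refl)
    have "defect (K - {x}) (K - {y}) f = 0" unfolding d using that(5) by linarith
    then have "defect (K - {x}) (K - {y}) g = 0" using that(1) by (intro tight) auto
    then show ?thesis unfolding d by linarith
  qed
  \<comment> \<open>Proper subsets of \<open>I\<close> have fewer than \<open>k\<close> elements, so
    they avoid \<open>C\<close> and both functions vanish there; the tight pair then forces
    \<open>g I = 0\<close>.\<close>
  have g_zero: "g I = 0" if "I \<subseteq> {1..n}" "card I \<le> k" "I \<notin> C" for I
    using that
  proof (induction "card I" arbitrary: I rule: less_induct)
    case less
    note finI = fin[OF less.prems(1)]
    show ?case
    proof (cases "card I \<le> 1")
      case True
      then show ?thesis using small less.prems by simp
    next
      case False
      then obtain x y where xy: "x \<in> I" "y \<in> I" "x \<noteq> y" using two[of I] by auto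
      have sub: "g J = 0 \<and> f J = 0" if J: "J \<subset> I" for J
      proof -
        have "card J < card I" using finI J by (rule psubset_card_mono)
        then have "J \<notin> C" using less.prems(2) C_card by auto
        then show ?thesis using less \<open>card J < card I\<close> J by (auto intro!: f_zero)
      qed
      have s: "I - {x} \<subset> I" "I - {y} \<subset> I" "I - {x, y} \<subset> I" using xy by auto
      have "f I = 0" using less.prems by (intro f_zero) auto
      then show ?thesis using step[OF less.prems(1) xy] s[THEN sub] by simp
    qed
  qed
  \<comment> \<open>For \<open>K = insert z A\<close> and \<open>y\<close> in \<open>A\<close>, the
    \<open>k\<close>-set \<open>K - {y}\<close> meets \<open>A\<close> in \<open>k - 1\<close>
    elements and so is not in \<open>C\<close>. The pair \<open>A\<close>, \<open>K - {y}\<close> is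
    tight, as \<open>1 + 0 = 1 + 0\<close>.\<close>
  have g_C: "g (insert z A) = g A" if A: "A \<in> C" and z: "z \<in> {1..n}" "z \<notin> A" for z A
  proof -
    have sA: "A \<subseteq> {1..n}" and cA: "card A = k" and fA: "finite A"
      using A C_subset C_card fin by auto
    have "A \<noteq> {}" using cA k_ge by auto
    then obtain y where y: "y \<in> A" by blast
    let ?K = "insert z A"
    have K: "?K \<subseteq> {1..n}" "?K - {z} = A" "z \<noteq> y" using sA z y by auto
    have c1: "card ?K = k + 1" using fA z cA by simp
    have c2: "card (?K - {y}) = k" using c1 y fA by simp
    have "?K - {z, y} = A - {y}" using z by auto
    then have c3: "card (?K - {z, y}) = k - 1" using cA y fA by simp
    have "A \<inter> (?K - {y}) = ?K - {z, y}" using z by auto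
    then have n2: "?K - {y} \<notin> C"
      using C_separated[OF A, of "?K - {y}"] c3 y k_ge by auto
    have n3: "?K - {z, y} \<notin> C" using c3 C_card k_ge by fastforce
    have "f A = 1" "f ?K = 1" using f_mem[OF A] f_not_mem[of ?K] c1 by simp_all
    moreover have "f (?K - {y}) = 0" "g (?K - {y}) = 0"
      using c2 n2 subset_trans[OF Diff_subset K(1)] by (intro f_zero g_zero; simp)+
    moreover have "f (?K - {z, y}) = 0" "g (?K - {z, y}) = 0"
      using c3 n3 sA by (intro f_zero g_zero; auto)+
    ultimately show ?thesis
      using step[OF K(1) _ _ K(3)] y unfolding K(2) by auto
  qed
  have pair: "g (K - {x}) + g (K - {y}) = g K"
    if K: "K \<subseteq> {1..n}" "card K = k + 2" and xy: "x \<in> K" "y \<in> K" "x \<noteq> y" and nC: "K - {x, y} \<notin> C" for K x y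
  proof -
    have c: "card (K - {x}) = k + 1" "card (K - {y}) = k + 1" "card (K - {x, y}) = k"
      using K xy fin by (auto simp: card_Diff_subset)
    have "f (K - {x}) = 1" "f (K - {y}) = 1" "f K = 2"
      using c K(2) by (simp_all add: f_not_mem)
    moreover have "f (K - {x, y}) = 0" using c nC by (intro f_zero) auto
    moreover have "g (K - {x, y}) = 0" using K c nC by (intro g_zero) auto
    ultimately show ?thesis using step[OF K(1) xy] by simp
  qed
  \<comment> \<open>If \<open>K - {x, y}\<close> is in \<open>C\<close>, both sides equal its value
    by \<open>g_C\<close>. Otherwise \<open>pair\<close> makes both equal to
    \<open>g K - g (K - {z})\<close> for a suitable third element \<open>z\<close>.\<close>
  have local_const: "g (K - {x}) = g (K - {y})"
    if K: "K \<subseteq> {1..n}" "card K = k + 2" and xy: "x \<in> K" "y \<in> K" for K x y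
  proof -
    consider "x = y" | "x \<noteq> y" "K - {x, y} \<in> C" | "x \<noteq> y" "K - {x, y} \<notin> C" by blast
    then show ?thesis
    proof cases
      case 2
      have "insert y (K - {x, y}) = K - {x}" "insert x (K - {x, y}) = K - {y}" using xy 2(1) by auto
      moreover have "g (insert y (K - {x, y})) = g (K - {x, y})"
        by (rule g_C[OF 2(2)]) (use xy K in auto)
      moreover have "g (insert x (K - {x, y})) = g (K - {x, y})"
        by (rule g_C[OF 2(2)]) (use xy K in auto)
      ultimately show ?thesis by simp
    next
      case 3
      \<comment> \<open>The pairs whose removal from \<open>K\<close> yields a member of \<open>C\<close> form a matching, so among
        three further elements one is matched to neither \<open>x\<close> nor \<open>y\<close>.\<close>
      have "card (K - {x, y}) \<ge> 3" using K xy 3 fin k_ge by (simp add: card_Diff_subset)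
      then obtain T where "T \<subseteq> K - {x, y}" "card T = 3" by (rule obtain_subset_with_card_n)
      then obtain a b c where abc: "a \<in> K - {x, y}" "b \<in> K - {x, y}" "c \<in> K - {x, y}"
        "a \<noteq> b" "a \<noteq> c" "b \<noteq> c" by (auto simp: card_3_iff)
      have ux: "z = z'" if "z \<in> K - {x, y}" "z' \<in> K - {x, y}" "K - {x, z} \<in> C" "K - {x, z'} \<in> C" for z z'
        using remove_remove_unique[of K x z z'] that K xy fin by auto
      have uy: "z = z'" if "z \<in> K - {x, y}" "z' \<in> K - {x, y}" "K - {y, z} \<in> C" "K - {y, z'} \<in> C" for z z'
        using remove_remove_unique[of K y z z'] that K xy fin by auto
      have "\<exists>z\<in>K - {x, y}. K - {x, z} \<notin> C \<and> K - {y, z} \<notin> C"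
        using abc ux uy by metis
      then obtain z where z: "z \<in> K" "z \<noteq> x" "z \<noteq> y" "K - {x, z} \<notin> C" "K - {y, z} \<notin> C" by auto
      then show ?thesis using pair[OF K xy(1) z(1)] pair[OF K xy(2) z(1)] by auto
    qed simp
  qed
  \<comment> \<open>Exchanging an element of \<open>I - J\<close> for one of \<open>J - I\<close>
    stays among the \<open>(k + 1)\<close>-subsets of one \<open>(k + 2)\<close>-set, where
    \<open>local_const\<close> applies, and brings \<open>I\<close> closer to
    \<open>J\<close>.\<close>
  have const: "g I = g J" if "I \<subseteq> {1..n}" "J \<subseteq> {1..n}" "card I = k + 1" "card J = k + 1" for I J
    using that
  proof (induction "card (I - J)" arbitrary: I rule: less_induct)
    case less
    have finIJ: "finite I" "finite J" using less.prems fin by auto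
    show ?case
    proof (cases "I = J")
      case False
      have "\<not> I \<subseteq> J" "\<not> J \<subseteq> I"
        using False less.prems finIJ card_subset_eq[of I J] card_subset_eq[of J I] by auto
      then obtain x y where xy: "x \<in> I" "x \<notin> J" "y \<in> J" "y \<notin> I" by auto
      let ?I' = "insert y (I - {x})"
      have c: "card ?I' = k + 1" using xy less.prems finIJ by simp
      have e: "?I' - J = (I - J) - {x}" using xy by auto
      have "card (?I' - J) < card (I - J)"
        unfolding e using xy finIJ by (intro card_Diff1_less) auto
      moreover have "?I' \<subseteq> {1..n}" using xy less.prems by auto
      ultimately have "g ?I' = g J" using less c by blast
      moreover have "g (insert y I - {x}) = g (insert y I - {y})"
        using xy less.prems finIJ by (intro local_const) auto
      moreover have "insert y I - {x} = ?I'" "insert y I - {y} = I" using xy by auto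
      ultimately show ?thesis by simp
    qed simp
  qed
  define c where "c = g {1..k + 1}"
  have g_Suc: "g I = c" if "I \<subseteq> {1..n}" "card I = k + 1" for I
    unfolding c_def using that k_le by (intro const) auto
  have g_large: "g I = c * real (card I - k)" if "I \<subseteq> {1..n}" "k + 1 \<le> card I" for I
    using that
  proof (induction "card I" arbitrary: I rule: less_induct)
    case less
    note finI = fin[OF less.prems(1)]
    \<comment> \<open>At size \<open>k + 2\<close> the intersection of a pair can lie in
      \<open>C\<close>, so the pair must be chosen to avoid this. From \<open>k + 3\<close> on, all
      four sets have more than \<open>k\<close> elements, where \<open>f\<close> is affine in the
      size and every such pair is tight.\<close>
    consider "card I = k + 1" | "card I = k + 2" | "card I \<ge> k + 3" using less.prems by linarith
    then show ?case
    proof cases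
      case 1
      then show ?thesis using g_Suc less.prems by simp
    next
      case 2
      have "3 \<le> card I" using 2 k_ge by simp
      then obtain T where "T \<subseteq> I" "card T = 3" by (rule obtain_subset_with_card_n)
      then obtain x y z where xyz: "x \<in> I" "y \<in> I" "z \<in> I" "x \<noteq> y" "x \<noteq> z" "y \<noteq> z" by (auto simp: card_3_iff)
      have "\<exists>y\<in>I. x \<noteq> y \<and> I - {x, y} \<notin> C"
        using remove_remove_unique[OF finI 2] xyz by metis
      then obtain y where y: "y \<in> I" "x \<noteq> y" "I - {x, y} \<notin> C" by blast
      have "g (I - {x}) = c" "g (I - {y}) = c"
        using less.prems xyz y 2 finI by (auto intro!: g_Suc)
      then show ?thesis using pair[OF less.prems(1) 2 xyz(1) y] 2 by simp
    next
      case 3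
      then obtain x y where xy: "x \<in> I" "y \<in> I" "x \<noteq> y" using two[of I] by auto
      have cs: "card (I - {x}) = card I - 1" "card (I - {y}) = card I - 1" "card (I - {x, y}) = card I - 2"
        using xy finI by (auto simp: card_Diff_subset)
      have sub: "I - {x} \<subseteq> {1..n}" "I - {y} \<subseteq> {1..n}" "I - {x, y} \<subseteq> {1..n}"
        using less.prems by auto
      have fs: "f I = real (card I - k)" "f (I - {x}) = real (card I - 1 - k)"
        "f (I - {y}) = real (card I - 1 - k)" "f (I - {x, y}) = real (card I - 2 - k)"
        using cs 3 by (auto simp: f_not_mem)
      have gs: "g (I - {x}) = c * real (card I - 1 - k)" "g (I - {y}) = c * real (card I - 1 - k)"
        "g (I - {x, y}) = c * real (card I - 2 - k)"
        using less.hyps[of "I - {x}"] less.hyps[of "I - {y}"] less.hyps[of "I - {x, y}"] cs sub 3 by auto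
      have "g (I - {x}) + g (I - {y}) = g I + g (I - {x, y})"
        using xy 3 fs by (intro step less.prems) auto
      then have "g I = c * (2 * real (card I - 1 - k) - real (card I - 2 - k))"
        using gs by (simp add: algebra_simps)
      also have "2 * real (card I - 1 - k) - real (card I - 2 - k) = real (card I - k)"
        using 3 by simp
      finally show ?thesis .
    qed
  qed
  have "g I = c * f I" if I: "I \<subseteq> {1..n}" for I
  proof -
    consider "I \<in> C" | "I \<notin> C" "card I \<le> k" | "card I \<ge> k + 1" by linarith
    then show ?thesis
    proof cases
      case 1
      \<comment> \<open>A member of \<open>C\<close> is not the whole ground set, so it extends to a
        \<open>(k + 1)\<close>-set with the same value of \<open>g\<close>, namely
        \<open>c\<close>.\<close>
      have "card I < card {1..n}" using 1 C_card k_le by simp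
      then have "\<not> {1..n} \<subseteq> I" using card_mono[OF fin[OF I]] by (metis not_less)
      then obtain z where z: "z \<in> {1..n}" "z \<notin> I" by blast
      then have "g (insert z I) = c" using I fin[OF I] 1 C_card by (intro g_Suc) auto
      then show ?thesis using g_C[OF 1 z] f_mem[OF 1] by simp
    next
      case 2
      then show ?thesis using g_zero[OF I] f_zero[of I] by simp
    next
      case 3
      then show ?thesis using g_large[OF I] f_not_mem[of I] by simp
    qed
  qed
  then show ?thesis by blast
qed

lemma tight_supermodular_imp_equivalent:
  assumes g: "supermodular n g"
    and tight: "\<And>I J. I \<subseteq> {1..n} \<Longrightarrow> J \<subseteq> {1..n} \<Longrightarrow> defect I J f = 0 \<Longrightarrow> defect I J g = 0"
  shows "\<exists>c\<ge>0. equivalent n g (\<lambda>I. c * f I)"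
proof -
  let ?h = "\<lambda>I. g I - modular_part g I"
  have fin: "finite I" if "I \<subseteq> {1..n}" for I using that finite_subset by blast
  have h: "defect I J ?h = defect I J g" if "I \<subseteq> {1..n}" "J \<subseteq> {1..n}" for I J
    using that fin by (simp add: defect_diff defect_modular_part)
  have "\<exists>c. \<forall>I\<subseteq>{1..n}. ?h I = c * f I"
    by (rule tight_normalized_imp_multiple) (use fin tight h in \<open>auto simp: modular_part_small\<close>)
  then obtain c where c: "\<And>I. I \<subseteq> {1..n} \<Longrightarrow> ?h I = c * f I" by blast
  have d: "defect I J g = c * defect I J f" if "I \<subseteq> {1..n}" "J \<subseteq> {1..n}" for I J
  proof -
    have "I \<inter> J \<subseteq> {1..n}" "I \<union> J \<subseteq> {1..n}" using that by auto
    then have "defect I J ?h = defect I J (\<lambda>I. c * f I)"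
      using that by (simp only: defect_def c)
    then show ?thesis using h[OF that] by (simp add: defect_scale)
  qed
  \<comment> \<open>The sign of \<open>c\<close> is read off at a pair where \<open>f\<close> has
    positive defect.\<close>
  obtain I J where IJ: "I \<subseteq> {1..n}" "J \<subseteq> {1..n}" "defect I J f \<noteq> 0"
    using not_modular_f by (auto simp: modular_iff_defect)
  then have "defect I J f \<ge> 0" "defect I J g \<ge> 0"
    using supermodular_f g unfolding supermodular_iff_defect by blast+
  then have "c \<ge> 0" using d[OF IJ(1,2)] IJ(3) by (auto simp: zero_le_mult_iff)
  then show ?thesis using d by (auto simp: equivalent_iff_defect defect_scale)
qed

text \<open>The defects of the two summands are nonnegative and add up to that of \<open>f\<close>,
  so each summand inherits every tight pair of \<open>f\<close>.\<close>

lemma irreducible_f: "irreducible_supermodular n f"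
  unfolding irreducible_supermodular_def
proof (intro conjI allI impI)
  fix g1 g2 assume g: "supermodular n g1" "supermodular n g2"
    and sum: "\<forall>I. I \<subseteq> {1..n} \<longrightarrow> f I = g1 I + g2 I"
  have tight: "defect I J g1 = 0 \<and> defect I J g2 = 0"
    if IJ: "I \<subseteq> {1..n}" "J \<subseteq> {1..n}" "defect I J f = 0" for I J
  proof -
    have "I \<inter> J \<subseteq> {1..n}" "I \<union> J \<subseteq> {1..n}" using IJ by auto
    then have "defect I J f = defect I J g1 + defect I J g2"
      using IJ sum by (simp add: defect_def)
    then show ?thesis
      using IJ g by (simp add: supermodular_iff_defect add_nonneg_eq_0_iff)
  qed
  show "\<exists>c\<ge>0. equivalent n g1 (\<lambda>I. c * f I)"
    using tight by (intro tight_supermodular_imp_equivalent[OF g(1)]) simp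
  show "\<exists>c\<ge>0. equivalent n g2 (\<lambda>I. c * f I)"
    using tight by (intro tight_supermodular_imp_equivalent[OF g(2)]) simp
qed (use supermodular_f not_modular_f in auto)

end

text \<open>Both functions vanish on sets of size at most 1, so their modular difference is zero.
  The value \<open>n - k\<close> at the full set then forces \<open>c = 1\<close>, and the extra
  units reveal the family.\<close>

lemma paving_nullity_equivalent_imp_eq:
  assumes "sparse_paving n k C" "sparse_paving n k D"
    and eq: "equivalent n (paving_nullity k D) (\<lambda>I. c * paving_nullity k C I)"
  shows "C = D"
proof -
  interpret C: sparse_paving n k C by fact
  interpret D: sparse_paving n k D by fact
  have z: "D.f I - c * C.f I = 0" if "I \<subseteq> {1..n}" for I
    by (rule modular_zero_if_small_zero[OF eq[unfolded equivalent_def] _ that])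
      (simp add: C.f_small D.f_small)
  have "real (n - k) = c * real (n - k)"
    using z[of "{1..n}"] C.k_le by (simp add: C.f_not_mem D.f_not_mem)
  then have "c = 1" using C.k_le by simp
  then have "I \<in> C \<longleftrightarrow> I \<in> D" if "I \<subseteq> {1..n}" for I
    using z[OF that] by (auto simp: paving_nullity_def split: if_splits)
  then show ?thesis using C.C_subset D.C_subset by blast
qed

section \<open>The lower bound\<close>

text \<open>The Graham--Sloane code: changing one element of a set changes its sum modulo \<open>n\<close>.\<close>

definition sum_class :: "nat \<Rightarrow> nat \<Rightarrow> nat \<Rightarrow> nat set set" where
  "sum_class n k a = {A. A \<subseteq> {1..n} \<and> card A = k \<and> \<Sum>A mod n = a}"

text \<open>Two \<open>k\<close>-sets violating the bound differ by exchanging some \<open>x\<close>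
  for some \<open>y\<close>. Equal sums modulo \<open>n\<close> would make \<open>n\<close> divide
  \<open>x - y\<close>, impossible for distinct elements of \<open>{1..n}\<close>.\<close>

lemma sum_class_separated:
  assumes A: "A \<in> sum_class n k a" and B: "B \<in> sum_class n k a" and ne: "A \<noteq> B"
  shows "card (A \<inter> B) + 2 \<le> k"
proof (rule ccontr)
  assume close: "\<not> card (A \<inter> B) + 2 \<le> k"
  have sub: "A \<subseteq> {1..n}" "B \<subseteq> {1..n}" and cards: "card A = k" "card B = k"
    and sums: "\<Sum>A mod n = \<Sum>B mod n"
    using A B by (auto simp: sum_class_def)
  have fin: "finite A" "finite B" using sub finite_subset by blast+
  have "card (A - B) = k - card (A \<inter> B)" "card (B - A) = k - card (A \<inter> B)"
    using cards fin card_Diff_subset_Int[of A B] card_Diff_subset_Int[of B A] by (auto simp: Int_commute)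
  moreover have "card (A - B) \<noteq> 0"
    using fin ne cards card_subset_eq[of B A] by auto
  ultimately have "card (A - B) = 1" "card (B - A) = 1" using close by linarith+
  then obtain x y where xy: "A - B = {x}" "B - A = {y}" by (metis card_1_singletonE)
  have sA: "\<Sum>A = x + \<Sum>(A \<inter> B)" and sB: "\<Sum>B = y + \<Sum>(A \<inter> B)"
    using sum.Int_Diff[OF fin(1), of "\<lambda>x. x" B] sum.Int_Diff[OF fin(2), of "\<lambda>x. x" A] xy
    by (auto simp: Int_commute)
  have range: "x \<in> {1..n}" "y \<in> {1..n}" "x \<noteq> y" using xy sub by auto
  have "(int x + int (\<Sum>(A \<inter> B))) mod int n = (int y + int (\<Sum>(A \<inter> B))) mod int n"
    using sums unfolding sA sB by (metis of_nat_add of_nat_mod)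
  then have "int n dvd int x - int y" by (simp add: mod_eq_dvd_iff)
  then have "\<bar>int n\<bar> \<le> \<bar>int x - int y\<bar>" using range by (intro dvd_imp_le_int) auto
  then show False using range by auto
qed

lemma finite_sum_class: "finite (sum_class n k a)"
  by (rule finite_subset[of _ "Pow {1..n}"]) (auto simp: sum_class_def)

text \<open>Pigeonhole over the \<open>n\<close> residues.\<close>

lemma exists_large_sum_class:
  assumes "n > 0"
  shows "\<exists>a. n choose k \<le> n * card (sum_class n k a)"
proof (rule ccontr)
  assume "\<nexists>a. n choose k \<le> n * card (sum_class n k a)"
  then have lt: "n * card (sum_class n k a) < n choose k" for a by (simp add: not_le)
  have "{A. A \<subseteq> {1..n} \<and> card A = k} = (\<Union>a<n. sum_class n k a)"
    using assms by (auto simp: sum_class_def)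
  then have "n choose k = card (\<Union>a<n. sum_class n k a)"
    using n_subsets[of "{1..n}" k] by simp
  also have "\<dots> \<le> (\<Sum>a<n. card (sum_class n k a))" by (rule card_UN_le) simp
  finally have "n * (n choose k) \<le> (\<Sum>a<n. n * card (sum_class n k a))"
    by (simp flip: sum_distrib_left)
  also have "\<dots> < (\<Sum>a<n. n choose k)" using assms lt by (intro sum_strict_mono) auto
  finally show False by simp
qed

lemma num_irreducible_ge_sum_class:
  assumes "3 \<le> k" "k + 2 \<le> n"
  shows "2 ^ card (sum_class n k a) \<le> num_irreducible n"
proof -
  have sp: "sparse_paving n k X" if X: "X \<subseteq> sum_class n k a" for X
  proof
    show "card (A \<inter> B) + 2 \<le> k" if "A \<in> X" "B \<in> X" "A \<noteq> B" for A B
      using that X by (intro sum_class_separated[of A n k a B]) auto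
  qed (use assms X in \<open>auto simp: sum_class_def\<close>)
  have irr: "irreducible_supermodular n (paving_nullity k X)" if "X \<subseteq> sum_class n k a" for X
    by (rule sparse_paving.irreducible_f[OF sp[OF that]])
  let ?F = "\<lambda>X. irreducible_rel n `` {paving_nullity k X}"
  have "inj_on ?F (Pow (sum_class n k a))"
  proof (rule inj_onI)
    fix X Y assume X: "X \<in> Pow (sum_class n k a)" and Y: "Y \<in> Pow (sum_class n k a)"
      and eq: "?F X = ?F Y"
    have "paving_nullity k Y \<in> ?F Y"
      using irr Y equiv_class_self[OF equiv_irreducible_rel] by simp
    then obtain c where "equivalent n (paving_nullity k Y) (\<lambda>I. c * paving_nullity k X I)"
      unfolding eq[symmetric] by (auto simp: irreducible_rel_def)
    with X Y show "X = Y"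
      by (intro paving_nullity_equivalent_imp_eq[OF sp sp]) auto
  qed
  moreover have "?F ` Pow (sum_class n k a) \<subseteq> irreducible_classes n"
    unfolding irreducible_classes_def using irr by (auto intro!: quotientI)
  \<comment> \<open>An infinite set has \<open>card\<close> equal to 0, so the lower bound relies on
    the finiteness obtained with the upper bound.\<close>
  moreover have "finite (irreducible_classes n)" using irreducible_classes_bound by blast
  ultimately have "card (Pow (sum_class n k a)) \<le> card (irreducible_classes n)"
    by (rule card_inj_on_le)
  then show ?thesis
    by (simp add: card_Pow finite_sum_class num_irreducible_def)
qed

section \<open>Lower estimate for the middle binomial coefficient, first squared to stay within the
  naturals\<close>

lemma central_binomial_ge:
  assumes "m \<ge> 1"
  shows "16 ^ m \<le> 4 * m * (2 * m choose m)\<^sup>2"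
  using assms
proof (induction m rule: nat_induct_at_least)
  case base
  show ?case by simp
next
  case (Suc m)
  let ?C = "2 * m choose m" and ?C' = "2 * Suc m choose Suc m"
  have rec: "Suc m * ?C' = 2 * (2 * m + 1) * ?C"
  proof -
    have "Suc (2 * m) choose m = Suc (2 * m) choose Suc m"
      by (subst binomial_symmetric) (auto simp: Suc_diff_le)
    then have "Suc m * (Suc (2 * m) choose m) = Suc (2 * m) * ?C"
      by (simp only: Suc_times_binomial)
    moreover have "Suc m * ?C' = Suc m * (2 * (Suc (2 * m) choose m))"
      using Suc_times_binomial[of m "Suc (2 * m)"] by (simp add: algebra_simps)
    ultimately show ?thesis by simp
  qed
  \<comment> \<open>The factor \<open>m * Suc m\<close> clears the denominators of the recurrence
    \<open>rec\<close> and is cancelled at the end because \<open>m\<close> is positive.\<close>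
  have "16 ^ Suc m * (m * Suc m) \<le> 16 * (4 * m * ?C\<^sup>2) * (m * Suc m)"
    using Suc.IH by (intro mult_right_mono) auto
  also have "\<dots> \<le> 4 * m * (2 * (2 * m + 1) * ?C)\<^sup>2"
  proof -
    have "4 * (m * Suc m) \<le> (2 * m + 1)\<^sup>2" by (simp add: power2_eq_square algebra_simps)
    then have "16 * m * ?C\<^sup>2 * (4 * (m * Suc m)) \<le> 16 * m * ?C\<^sup>2 * (2 * m + 1)\<^sup>2"
      by (rule mult_left_mono) simp
    then show ?thesis by (simp add: power2_eq_square algebra_simps)
  qed
  also have "\<dots> = 4 * m * (Suc m * ?C')\<^sup>2" by (simp only: rec)
  also have "\<dots> = (4 * Suc m * ?C'\<^sup>2) * (m * Suc m)"
    by (simp only: power2_eq_square mult_ac)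
  finally show ?case using Suc.hyps by simp
qed

lemma middle_binomial_ge:
  assumes "n \<ge> 2"
  shows "2 ^ n / (4 * sqrt n) \<le> real (n choose (n div 2))"
proof -
  define m where "m = n div 2"
  have m: "m \<ge> 1" "2 * m \<le> n" "n \<le> 2 * m + 1" using assms by (auto simp: m_def)
  let ?C = "real (2 * m choose m)"
  have "real (16 ^ m) \<le> real (4 * m * (2 * m choose m)\<^sup>2)"
    using central_binomial_ge[OF m(1)] of_nat_le_iff by blast
  then have "(4 ^ m)\<^sup>2 \<le> (2 * sqrt m * ?C)\<^sup>2"
    by (simp add: power_mult_distrib mult.commute[of m 2] power_mult flip: power_mult[of _ m 2])
  then have "4 ^ m \<le> 2 * sqrt m * ?C" by (rule power2_le_imp_le) simp
  also have "\<dots> \<le> 2 * sqrt n * real (n choose m)"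
    using m by (intro mult_mono) (auto intro: binomial_right_mono)
  finally have "2 * 4 ^ m \<le> 4 * sqrt n * real (n choose m)" by simp
  \<comment> \<open>For odd \<open>n\<close>, rounding down to \<open>2 * m\<close> loses a factor
    2, which turns the constant 2 into 4.\<close>
  moreover have "(2::real) ^ n \<le> 2 ^ (2 * m + 1)" using m by (intro power_increasing) auto
  ultimately have "2 ^ n \<le> 4 * sqrt n * real (n choose m)" by (simp add: power_mult)
  then show ?thesis using assms by (simp add: divide_le_eq mult.commute m_def)
qed

section \<open>Explicit bounds and their asymptotic form\<close>

lemma num_irreducible_ge:
  assumes n: "n \<ge> 6"
  shows "2 powr (2 ^ n / (4 * real n powr (3 / 2))) \<le> real (num_irreducible n)"
proof -
  \<comment> \<open>From \<open>n \<ge> 6\<close> follow \<open>3 \<le> ?k\<close> and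
    \<open>?k + 2 \<le> n\<close>. The binomial estimate costs a factor \<open>sqrt n\<close> and
    the pigeonhole a factor \<open>n\<close>, whence the exponent \<open>3 / 2\<close>.\<close>
  let ?k = "n div 2"
  obtain a where a: "n choose ?k \<le> n * card (sum_class n ?k a)"
    using exists_large_sum_class[of n ?k] n by auto
  have "real n powr (3 / 2) = real n * sqrt n"
    using n powr_add[of "real n" 1 "1 / 2"] by (simp add: powr_half_sqrt)
  then have "2 ^ n / (4 * real n powr (3 / 2)) = 2 ^ n / (4 * sqrt n) / n" by simp
  also have "\<dots> \<le> real (n choose ?k) / n"
    using middle_binomial_ge[of n] n by (intro divide_right_mono) auto
  also have "\<dots> \<le> real (card (sum_class n ?k a))"
    using a n of_nat_le_iff[of "n choose ?k" "n * card (sum_class n ?k a)", where 'a = real]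
    by (simp add: divide_le_eq mult.commute)
  finally have "2 powr (2 ^ n / (4 * real n powr (3 / 2))) \<le> 2 powr real (card (sum_class n ?k a))"
    by simp
  also have "\<dots> = real (2 ^ card (sum_class n ?k a))" by (simp add: powr_realpow)
  also have "\<dots> \<le> real (num_irreducible n)"
    using num_irreducible_ge_sum_class[of ?k n a] n by (intro of_nat_mono) auto
  finally show ?thesis .
qed

lemma num_irreducible_le: "real (num_irreducible n) \<le> 2 powr (4 * (real n * 2 ^ n))"
proof -
  have "real (num_irreducible n) \<le> real ((4 ^ n) ^ (2 ^ n + 1))"
    using irreducible_classes_bound of_nat_le_iff by blast
  also have "\<dots> = 2 ^ (2 * n * (2 ^ n + 1))"
    by (simp only: of_nat_power of_nat_numeral power_mult) simp
  \<comment> \<open>Bounding \<open>2 ^ n + 1\<close> by \<open>2 * 2 ^ n\<close> produces the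
    constant 4.\<close>
  also have "\<dots> \<le> 2 ^ (2 * n * (2 * 2 ^ n))"
    by (intro power_increasing mult_left_mono) auto
  also have "\<dots> = 2 powr (4 * (real n * 2 ^ n))"
    by (simp flip: powr_realpow)
  finally show ?thesis .
qed

theorem theorem1p1:
  shows "(\<forall>n. finite (irreducible_classes n)) \<and>
    (\<exists>h \<in> O(\<lambda>n. real n * 2 ^ n).
       \<forall>\<^sub>F n in sequentially. real (num_irreducible n) \<le> 2 powr (h n)) \<and>
    (\<exists>h \<in> \<Omega>(\<lambda>n. 2 ^ n / real n powr (3 / 2)).
       \<forall>\<^sub>F n in sequentially. 0 \<le> h n \<and> real (num_irreducible n) \<ge> 2 powr (h n))"
proof (intro conjI allI)
  show "finite (irreducible_classes n)" for n using irreducible_classes_bound by blast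
  show "\<exists>h \<in> O(\<lambda>n. real n * 2 ^ n).
       \<forall>\<^sub>F n in sequentially. real (num_irreducible n) \<le> 2 powr (h n)"
    by (rule bexI[of _ "\<lambda>n. 4 * (real n * 2 ^ n)"]) (use num_irreducible_le in auto)
  show "\<exists>h \<in> \<Omega>(\<lambda>n. 2 ^ n / real n powr (3 / 2)).
       \<forall>\<^sub>F n in sequentially. 0 \<le> h n \<and> real (num_irreducible n) \<ge> 2 powr (h n)"
  proof (rule bexI)
    let ?h = "\<lambda>n. 2 ^ n / (4 * real n powr (3 / 2))"
    show "\<forall>\<^sub>F n in sequentially. 0 \<le> ?h n \<and> real (num_irreducible n) \<ge> 2 powr (?h n)"
      using eventually_ge_at_top[of 6] by eventually_elim (use num_irreducible_ge in auto)
    show "?h \<in> \<Omega>(\<lambda>n. 2 ^ n / real n powr (3 / 2))"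
      by (rule landau_omega.bigI[of "1 / 4"]) auto
  qed
qed

end
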